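(* Let $(X,\mathcal{S})$ be a complete $S$-metric space, let $T:X\to X$ be a self-mapping, and let $a,b\in[0,1)$ and $c\in[0,\tfrac12]$. For $x,y\in X$ put $$M_z^S(x,y)=\max\left\{a\,\mathcal{S}(x,x,y),\ \tfrac{b}{2}\left[\mathcal{S}(x,x,Tx)+\mathcal{S}(y,y,Ty)\right],\ \tfrac{c}{2}\left[\mathcal{S}(x,x,Ty)+\mathcal{S}(y,y,Tx)\right]\right\}.$$ Suppose that: (i) there exists a function $\phi:\mathbb{R}^+\to\mathbb{R}^+$ such that $\phi(t)<t$ for each $t>0$ and $\mathcal{S}(Tx,Tx,Ty)\le\phi\left(M_z^S(x,y)\right)$ for all $x,y\in X$; (ii) for every $\varepsilon>0$ there exists $\delta=\delta(\varepsilon)>0$ such that, for all $x,y\in X$, $\varepsilon<M_z^S(x,y)<\varepsilon+\delta$ implies $\mathcal{S}(Tx,Tx,Ty)\le\varepsilon$. Then $T$ has a unique fixed point $u\in X$. Moreover, $T$ is discontinuous at $u$ if and only if $\lim_{x\to u}M_z^S(x,u)\neq 0$.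
   Context: An $S$-metric on a nonempty set $X$ is a function $\mathcal{S}:X\times X\times X\to[0,\infty)$ such that for all $x,y,z,w\in X$: (S1) $\mathcal{S}(x,y,z)=0$ if and only if $x=y=z$; (S2) $\mathcal{S}(x,y,z)\le\mathcal{S}(x,x,w)+\mathcal{S}(y,y,w)+\mathcal{S}(z,z,w)$. The pair $(X,\mathcal{S})$ is then an $S$-metric space. A sequence $\{x_n\}$ converges to $x$ if $\mathcal{S}(x_n,x_n,x)\to0$; it is Cauchy if for every $\varepsilon>0$ there is $n_0$ with $\mathcal{S}(x_n,x_n,x_m)<\varepsilon$ for all $n,m\ge n_0$; the space is complete if every Cauchy sequence converges. $T$ is continuous at $u$ if $x_n\to u$ implies $Tx_n\to Tu$, and discontinuous at $u$ otherwise. "$\lim_{x\to u}M_z^S(x,u)=0$" means $M_z^S(x_n,u)\to0$ for every sequence $x_n\to u$, and "$\lim_{x\to u}M_z^S(x,u)\ne0$" is the negation of this. $\mathbb{R}^+=[0,\infty)$.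
   Formalization: The formal theorem additionally requires φ(0)=0 when a=0 and (b=0 or c=0); without it the claim fails there, e.g. the swap on a discrete two-point space with a=b=0, φ(0)=1 has no fixed point, and the identity with a=c=0 has two. *)

theory Defs
  imports Complex_Main "HOL-Library.FuncSet"
begin

locale S_metric_space =
  fixes X :: "'a set" and S :: "'a \<Rightarrow> 'a \<Rightarrow> 'a \<Rightarrow> real"
  assumes nonempty: "X \<noteq> {}"
    and nonneg: "\<lbrakk>x \<in> X; y \<in> X; z \<in> X\<rbrakk> \<Longrightarrow> 0 \<le> S x y z"
    and zero_iff: "\<lbrakk>x \<in> X; y \<in> X; z \<in> X\<rbrakk> \<Longrightarrow> S x y z = 0 \<longleftrightarrow> x = y \<and> y = z"
    and S_triangle: "\<lbrakk>x \<in> X; y \<in> X; z \<in> X; w \<in> X\<rbrakk>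
      \<Longrightarrow> S x y z \<le> S x x w + S y y w + S z z w"

definition S_converges ::
    "'a set \<Rightarrow> ('a \<Rightarrow> 'a \<Rightarrow> 'a \<Rightarrow> real) \<Rightarrow> (nat \<Rightarrow> 'a) \<Rightarrow> 'a \<Rightarrow> bool" where
  "S_converges X S s u \<longleftrightarrow>
     range s \<subseteq> X \<and> u \<in> X \<and> (\<lambda>n. S (s n) (s n) u) \<longlonglongrightarrow> 0"

definition S_Cauchy :: "'a set \<Rightarrow> ('a \<Rightarrow> 'a \<Rightarrow> 'a \<Rightarrow> real) \<Rightarrow> (nat \<Rightarrow> 'a) \<Rightarrow> bool" where
  "S_Cauchy X S s \<longleftrightarrow>
     range s \<subseteq> X \<and> (\<forall>\<epsilon>>0. \<exists>n0. \<forall>n\<ge>n0. \<forall>m\<ge>n0. S (s n) (s n) (s m) < \<epsilon>)"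

locale complete_S_metric_space = S_metric_space +
  assumes complete: "S_Cauchy X S s \<Longrightarrow> \<exists>u. S_converges X S s u"

definition S_continuous_at ::
    "'a set \<Rightarrow> ('a \<Rightarrow> 'a \<Rightarrow> 'a \<Rightarrow> real) \<Rightarrow> ('a \<Rightarrow> 'a) \<Rightarrow> 'a \<Rightarrow> bool" where
  "S_continuous_at X S T u \<longleftrightarrow>
     (\<forall>s. S_converges X S s u \<longrightarrow> S_converges X S (\<lambda>n. T (s n)) (T u))"

definition MzS ::
    "('a \<Rightarrow> 'a \<Rightarrow> 'a \<Rightarrow> real) \<Rightarrow> ('a \<Rightarrow> 'a) \<Rightarrow> real \<Rightarrow> real \<Rightarrow> real \<Rightarrow> 'a \<Rightarrow> 'a \<Rightarrow> real" where
  "MzS S T a b c x y =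
     Max {a * S x x y,
          b / 2 * (S x x (T x) + S y y (T y)),
          c / 2 * (S x x (T y) + S y y (T x))}"

text \<open>The sequences below are not required to avoid the point \<open>u\<close>.\<close>

definition S_lim_zero ::
    "'a set \<Rightarrow> ('a \<Rightarrow> 'a \<Rightarrow> 'a \<Rightarrow> real) \<Rightarrow> ('a \<Rightarrow> real) \<Rightarrow> 'a \<Rightarrow> bool" where
  "S_lim_zero X S f u \<longleftrightarrow>
     (\<forall>s. S_converges X S s u \<longrightarrow> (\<lambda>n. f (s n)) \<longlonglongrightarrow> 0)"

end

theory Submission imports Defs begin

text \<open>
  Write \<open>d x y\<close> for \<open>S x x y\<close> and \<open>M x y\<close> for \<open>MzS S T a b c x y\<close>.  Taking two equal entries
  in (S2) shows that \<open>d\<close> is symmetric and that \<open>d x y \<le> 2 * d x z + d z y\<close>, so \<open>d\<close> is almost a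
  metric: the triangle inequality loses only a factor 2 on one side.

  The argument rests on the single inequality \<open>d (T x) (T y) \<le> M x y\<close>.  Where \<open>M x y > 0\<close> it is
  immediate from \<open>\<phi> t < t\<close>.  Where \<open>M x y = 0\<close> one has to see that \<open>T x = T y\<close>: if \<open>a > 0\<close>, or
  if \<open>b\<close> and \<open>c\<close> are both positive, then vanishing of \<open>M x y\<close> forces \<open>x = y\<close>; in the
  remaining cases \<open>\<phi> 0 = 0\<close>.

  This inequality makes consecutive distances of a Picard orbit decay geometrically
  (lemma \<open>orbit_step\<close>).  Indeed, put \<open>p = d x (T x)\<close> and \<open>q = d (T x) (T (T x))\<close>.  The three
  terms of \<open>M x (T x)\<close> are at most \<open>a * p\<close>, \<open>b / 2 * (p + q)\<close> and, by the weak triangle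
  inequality and \<open>c \<le> 1 / 2\<close>, \<open>(2 * p + q) / 4\<close>; whichever of them bounds \<open>q\<close>, it follows that
  \<open>q \<le> max a (max b (2 / 3)) * p\<close>.  Hence orbits are Cauchy.  At the limit \<open>u\<close> of an orbit
  the inequality becomes \<open>d u (T u) \<le> max (b / 2) (c / 2) * d u (T u)\<close>, and so
  \<open>T u = u\<close>; two fixed points coincide because \<open>a\<close> and \<open>c\<close> are smaller than 1.

  At a fixed point \<open>u\<close> the claim about continuity is a comparison of two quantities:
  \<open>d (T x) u \<le> M x u\<close>, while \<open>M x u\<close> is bounded by a combination of \<open>d x u\<close> and \<open>d (T x) u\<close>.
  Along a sequence tending to \<open>u\<close> one tends to 0 exactly when the other does.
\<close>

section \<open>The two-point function of an S-metric\<close>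

context S_metric_space
begin

lemma S_self: "x \<in> X \<Longrightarrow> S x x x = 0"
  using zero_iff by blast

lemma S_eq_0_iff: "x \<in> X \<Longrightarrow> y \<in> X \<Longrightarrow> S x x y = 0 \<longleftrightarrow> x = y"
  using zero_iff by auto

text \<open>Apply (S2) with the auxiliary point equal to the repeated entry: two of its three terms vanish.\<close>

lemma S_sym:
  assumes "x \<in> X" "y \<in> X"
  shows "S x x y = S y y x"
proof (rule antisym)
  show "S x x y \<le> S y y x"
    using S_triangle[of x x y x] S_self[of x] assms by simp
  show "S y y x \<le> S x x y"
    using S_triangle[of y y x y] S_self[of y] assms by simp
qed

lemma S_weak_triangle:
  assumes "x \<in> X" "y \<in> X" "z \<in> X"
  shows "S x x y \<le> 2 * S x x z + S z z y"
  using S_triangle[of x x y z] S_sym[of y z] assms by simp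

text \<open>The weak triangle inequality, applied in both directions, gives
  \<open>\<bar>S x x y - S u u y\<bar> \<le> 2 * S x x u\<close>, so the loss of the factor 2 is harmless for limits.\<close>

lemma tendsto_S:
  assumes "S_converges X S s u" "y \<in> X"
  shows "(\<lambda>n. S (s n) (s n) y) \<longlonglongrightarrow> S u u y"
proof -
  have s: "s n \<in> X" and u: "u \<in> X" for n
    using assms unfolding S_converges_def by auto
  have bound: "norm (S (s n) (s n) y - S u u y) \<le> norm (S (s n) (s n) u) * 2" for n
    using S_weak_triangle[OF s[of n] \<open>y \<in> X\<close> u] S_weak_triangle[OF u \<open>y \<in> X\<close> s[of n]]
      S_sym[OF u s[of n]] by simp
  have "(\<lambda>n. S (s n) (s n) u) \<longlonglongrightarrow> 0"
    using assms by (simp add: S_converges_def)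
  then have "(\<lambda>n. S (s n) (s n) y - S u u y) \<longlonglongrightarrow> 0"
    by (rule tendsto_0_le[OF _ always_eventually[OF allI[OF bound]]])
  then show ?thesis
    by (simp add: LIM_zero_iff)
qed

text \<open>Splitting off one step at a time at the left end point puts the factor 2 of the weak triangle
  inequality on the short steps only, so it does not accumulate and the bound is that of a
  geometric series.\<close>

lemma S_le_geometric:
  assumes x: "\<And>n. x n \<in> X" and k: "0 \<le> k" "k < 1"
    and step: "\<And>n. S (x n) (x n) (x (Suc n)) \<le> k ^ n * C"
  shows "S (x n) (x n) (x (n + j)) \<le> 2 * C / (1 - k) * k ^ n"
proof (induction j arbitrary: n)
  case 0
  have "0 \<le> C"
    using step[of 0] nonneg[OF x x x, of 0 0 1] by simp
  then show ?case
    using k S_self[OF x, of n] by simp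
next
  case (Suc j)
  have "S (x n) (x n) (x (n + Suc j))
      \<le> 2 * S (x n) (x n) (x (Suc n)) + S (x (Suc n)) (x (Suc n)) (x (Suc n + j))"
    using S_weak_triangle[OF x x x, of n "n + Suc j" "Suc n"] by simp
  also have "\<dots> \<le> 2 * (k ^ n * C) + 2 * C / (1 - k) * k ^ Suc n"
    using step[of n] Suc[of "Suc n"] by simp
  also have "\<dots> = 2 * C / (1 - k) * k ^ n"
    using k by (simp add: field_simps)
  finally show ?case .
qed

lemma S_Cauchy_geometric:
  assumes x: "\<And>n. x n \<in> X" and k: "0 \<le> k" "k < 1"
    and step: "\<And>n. S (x n) (x n) (x (Suc n)) \<le> k ^ n * C"
  shows "S_Cauchy X S x"
  unfolding S_Cauchy_def
proof (intro conjI allI impI)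
  show "range x \<subseteq> X"
    using x by auto
  fix e :: real assume "e > 0"
  have "(\<lambda>n. 2 * C / (1 - k) * k ^ n) \<longlonglongrightarrow> 2 * C / (1 - k) * 0"
    using k by (intro tendsto_mult_left LIMSEQ_realpow_zero) auto
  then have "eventually (\<lambda>n. 2 * C / (1 - k) * k ^ n < e) sequentially"
    using \<open>e > 0\<close> by (intro order_tendstoD) simp_all
  then obtain n0 where n0: "\<And>n. n \<ge> n0 \<Longrightarrow> 2 * C / (1 - k) * k ^ n < e"
    by (auto simp: eventually_sequentially)
  have ordered: "S (x n) (x n) (x m) < e" if "n0 \<le> n" "n \<le> m" for n m
    using S_le_geometric[OF x k step, of n "m - n"] n0[OF \<open>n0 \<le> n\<close>] that by simp
  have "S (x n) (x n) (x m) < e" if "n0 \<le> n" "n0 \<le> m" for n m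
    using ordered[of n m] ordered[of m n] S_sym[OF x x, of n m] that
    by (cases "n \<le> m") auto
  then show "\<exists>n0. \<forall>n\<ge>n0. \<forall>m\<ge>n0. S (x n) (x n) (x m) < e"
    by blast
qed

end

section \<open>Maps dominated by M\<close>

locale M_dominated_map = complete_S_metric_space X S
  for X :: "'a set" and S :: "'a \<Rightarrow> 'a \<Rightarrow> 'a \<Rightarrow> real" +
  fixes T :: "'a \<Rightarrow> 'a" and a b c :: real
  assumes T_closed: "x \<in> X \<Longrightarrow> T x \<in> X"
    and a: "0 \<le> a" "a < 1" and b: "0 \<le> b" "b < 1" and c: "0 \<le> c" "c \<le> 1 / 2"
    and dominated: "\<lbrakk>x \<in> X; y \<in> X\<rbrakk> \<Longrightarrow> S (T x) (T x) (T y) \<le> MzS S T a b c x y"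
begin

lemma orbit_step:
  assumes x: "x \<in> X"
  shows "S (T x) (T x) (T (T x)) \<le> max a (max b (2 / 3)) * S x x (T x)"
proof -
  let ?p = "S x x (T x)" and ?q = "S (T x) (T x) (T (T x))" and ?r = "S x x (T (T x))"
  note X = x T_closed[OF x] T_closed[OF T_closed[OF x]]
  have p: "0 \<le> ?p"
    using nonneg X by blast
  have scale: "t * ?p \<le> max a (max b (2 / 3)) * ?p" if "t \<in> {a, b, 2 / 3}" for t
    using that p by (intro mult_right_mono) auto
  have "c / 2 * ?r \<le> 1 / 4 * (2 * ?p + ?q)"
    using S_weak_triangle[OF X(1) X(3) X(2)] nonneg[OF X(1) X(1) X(3)] c
    by (intro mult_mono) auto
  moreover have "?q \<le> max (a * ?p) (max (b / 2 * (?p + ?q)) (c / 2 * ?r))"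
    using dominated[OF X(1) X(2)] S_self[OF X(2)] by (simp add: MzS_def)
  ultimately consider
      "?q \<le> a * ?p" | "?q \<le> b / 2 * (?p + ?q)" | "?q \<le> 1 / 4 * (2 * ?p + ?q)"
    by linarith
  then show ?thesis
  proof cases
    case 1
    then show ?thesis
      using scale[of a] by simp
  next
    case 2
    \<comment> \<open>If \<open>?p < ?q\<close>, the bound would give \<open>?q \<le> b * ?q\<close>; so \<open>?q \<le> ?p\<close>, and the bound is at
      most \<open>b * ?p\<close>.\<close>
    have "?q \<le> ?p"
    proof (rule ccontr)
      assume "\<not> ?q \<le> ?p"
      then have "b / 2 * (?p + ?q) \<le> b / 2 * (?q + ?q)"
        using b by (intro mult_left_mono) auto
      then have "(1 - b) * ?q \<le> 0"
        using 2 by (simp add: algebra_simps)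
      then show False
        using b p \<open>\<not> ?q \<le> ?p\<close> by (simp add: mult_le_0_iff)
    qed
    then have "b / 2 * (?p + ?q) \<le> b / 2 * (?p + ?p)"
      using b by (intro mult_left_mono) auto
    then show ?thesis
      using 2 scale[of b] by simp
  next
    case 3
    then show ?thesis
      using scale[of "2 / 3"] by simp
  qed
qed

lemma orbit_in_X: "x \<in> X \<Longrightarrow> (T ^^ n) x \<in> X"
  by (induction n) (auto intro: T_closed)

lemma orbit_step_geometric:
  assumes "x \<in> X"
  shows "S ((T ^^ n) x) ((T ^^ n) x) ((T ^^ Suc n) x) \<le> max a (max b (2 / 3)) ^ n * S x x (T x)"
proof (induction n)
  case 0
  show ?case by simp
next
  case (Suc n)
  let ?k = "max a (max b (2 / 3))"
  have "S ((T ^^ Suc n) x) ((T ^^ Suc n) x) ((T ^^ Suc (Suc n)) x)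
      \<le> ?k * S ((T ^^ n) x) ((T ^^ n) x) ((T ^^ Suc n) x)"
    using orbit_step[OF orbit_in_X[OF assms, of n]] by simp
  also have "\<dots> \<le> ?k * (?k ^ n * S x x (T x))"
    using Suc by (intro mult_left_mono) auto
  finally show ?case by (simp add: mult.assoc)
qed

text \<open>Let \<open>n\<close> tend to infinity in \<open>dominated\<close> for the \<open>n\<close>-th iterate and \<open>u\<close>; with
  \<open>D = S u u (T u)\<close> this reads \<open>D \<le> max 0 (max (b / 2 * D) (c / 2 * D))\<close>.\<close>

lemma orbit_limit_fixed:
  assumes x: "x \<in> X" and lim: "S_converges X S (\<lambda>n. (T ^^ n) x) u"
  shows "T u = u"
proof -
  let ?s = "\<lambda>n. (T ^^ n) x"
  let ?D = "S u u (T u)"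
  have s: "?s n \<in> X" for n
    by (rule orbit_in_X[OF x])
  have u: "u \<in> X"
    using lim by (simp add: S_converges_def)
  note Tu = T_closed[OF u]
  have lim_u: "(\<lambda>n. S (?s n) (?s n) u) \<longlonglongrightarrow> 0"
    using lim by (simp add: S_converges_def)
  have lim_Tu: "(\<lambda>n. S (?s n) (?s n) (T u)) \<longlonglongrightarrow> ?D"
    by (rule tendsto_S[OF lim Tu])
  have lim_Suc: "(\<lambda>n. S u u (?s (Suc n))) \<longlonglongrightarrow> 0"
    by (subst S_sym[OF u s]) (rule LIMSEQ_Suc[OF lim_u])
  have lim_step: "(\<lambda>n. S (?s n) (?s n) (?s (Suc n))) \<longlonglongrightarrow> 0"
  proof (rule tendsto_sandwich)
    show "eventually (\<lambda>n. 0 \<le> S (?s n) (?s n) (?s (Suc n))) sequentially"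
      by (rule always_eventually) (blast intro: nonneg[OF s s s])
    show "eventually (\<lambda>n. S (?s n) (?s n) (?s (Suc n))
        \<le> 2 * S (?s n) (?s n) u + S u u (?s (Suc n))) sequentially"
      by (rule always_eventually) (blast intro: S_weak_triangle[OF s s u])
    show "(\<lambda>n. 2 * S (?s n) (?s n) u + S u u (?s (Suc n))) \<longlonglongrightarrow> 0"
      using tendsto_add[OF tendsto_mult_left[OF lim_u, of 2] lim_Suc] by simp
  qed simp
  have "(\<lambda>n. max (a * S (?s n) (?s n) u)
      (max (b / 2 * (S (?s n) (?s n) (?s (Suc n)) + ?D))
        (c / 2 * (S (?s n) (?s n) (T u) + S u u (?s (Suc n))))))
    \<longlonglongrightarrow> max (a * 0) (max (b / 2 * (0 + ?D)) (c / 2 * (?D + 0)))"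
    by (intro tendsto_intros lim_u lim_step lim_Tu lim_Suc)
  moreover have "S (?s (Suc n)) (?s (Suc n)) (T u) \<le> max (a * S (?s n) (?s n) u)
      (max (b / 2 * (S (?s n) (?s n) (?s (Suc n)) + ?D))
        (c / 2 * (S (?s n) (?s n) (T u) + S u u (?s (Suc n)))))" for n
    using dominated[OF s[of n] u] by (simp add: MzS_def)
  ultimately have "?D \<le> max (a * 0) (max (b / 2 * (0 + ?D)) (c / 2 * (?D + 0)))"
    using LIMSEQ_le[OF LIMSEQ_Suc[OF lim_Tu]] by blast
  moreover have "b / 2 * ?D \<le> 1 / 2 * ?D" "c / 2 * ?D \<le> 1 / 2 * ?D"
    using b c nonneg[OF u u Tu] by (intro mult_right_mono; simp)+
  ultimately have "?D = 0"
    using nonneg[OF u u Tu] by simp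
  then show ?thesis
    using S_eq_0_iff[OF u Tu] by simp
qed

theorem fixed_point_exists: "\<exists>u\<in>X. T u = u"
proof -
  obtain x where x: "x \<in> X"
    using nonempty by blast
  let ?k = "max a (max b (2 / 3))"
  have "S_Cauchy X S (\<lambda>n. (T ^^ n) x)"
  proof (rule S_Cauchy_geometric)
    show "0 \<le> ?k" "?k < 1"
      using a b by auto
  qed (rule orbit_in_X[OF x] orbit_step_geometric[OF x])+
  then obtain u where u: "S_converges X S (\<lambda>n. (T ^^ n) x) u"
    using complete by blast
  then show ?thesis
    using orbit_limit_fixed[OF x u] by (auto simp: S_converges_def)
qed

theorem fixed_point_unique:
  assumes "u \<in> X" "T u = u" "v \<in> X" "T v = v"
  shows "u = v"
proof -
  let ?d = "S u u v"
  have d: "0 \<le> ?d"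
    using nonneg assms by blast
  have "?d \<le> max (a * ?d) (max 0 (c * ?d))"
    using dominated[of u v] S_self[of u] S_self[of v] S_sym[of u v] assms
    by (simp add: MzS_def)
  also have "\<dots> \<le> max a c * ?d"
    using d a by (simp add: mult_right_mono)
  finally have "(1 - max a c) * ?d \<le> 0"
    by (simp add: algebra_simps)
  then have "?d = 0"
    using d a c by (auto simp: mult_le_0_iff max_def split: if_splits)
  then show ?thesis
    using S_eq_0_iff assms by blast
qed

lemma MzS_fixed_point:
  assumes "u \<in> X" "T u = u"
  shows "MzS S T a b c x u
    = max (a * S x x u) (max (b / 2 * S x x (T x)) (c / 2 * (S x x u + S u u (T x))))"
  using assms S_self[of u] by (simp add: MzS_def)

text \<open>The forward direction needs \<open>S x x (T x)\<close> to tend to 0, which follows by passing through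
  \<open>u\<close>; the backward direction is \<open>dominated\<close> with \<open>y = u\<close>.\<close>

theorem continuous_at_fixed_point_iff:
  assumes u: "u \<in> X" and fixed: "T u = u"
  shows "S_continuous_at X S T u \<longleftrightarrow> S_lim_zero X S (\<lambda>x. MzS S T a b c x u) u"
proof
  assume cont: "S_continuous_at X S T u"
  show "S_lim_zero X S (\<lambda>x. MzS S T a b c x u) u"
    unfolding S_lim_zero_def
  proof (intro allI impI)
    fix s assume lim: "S_converges X S s u"
    then have s: "s n \<in> X" for n
      by (auto simp: S_converges_def)
    note Ts = T_closed[OF s]
    have lim_s: "(\<lambda>n. S (s n) (s n) u) \<longlonglongrightarrow> 0"
      using lim by (simp add: S_converges_def)
    have lim_Ts: "(\<lambda>n. S u u (T (s n))) \<longlonglongrightarrow> 0"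
      using cont lim fixed S_sym[OF u Ts] by (simp add: S_continuous_at_def S_converges_def)
    have lim_sTs: "(\<lambda>n. S (s n) (s n) (T (s n))) \<longlonglongrightarrow> 0"
    proof (rule tendsto_sandwich)
      show "eventually (\<lambda>n. 0 \<le> S (s n) (s n) (T (s n))) sequentially"
        by (rule always_eventually) (blast intro: nonneg[OF s s Ts])
      show "eventually (\<lambda>n. S (s n) (s n) (T (s n))
          \<le> 2 * S (s n) (s n) u + S u u (T (s n))) sequentially"
        by (rule always_eventually) (blast intro: S_weak_triangle[OF s Ts u])
      show "(\<lambda>n. 2 * S (s n) (s n) u + S u u (T (s n))) \<longlonglongrightarrow> 0"
        using tendsto_add[OF tendsto_mult_left[OF lim_s, of 2] lim_Ts] by simp
    qed simp
    have "(\<lambda>n. MzS S T a b c (s n) u) \<longlonglongrightarrow> max (a * 0) (max (b / 2 * 0) (c / 2 * (0 + 0)))"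
      unfolding MzS_fixed_point[OF u fixed]
      by (intro tendsto_intros lim_s lim_Ts lim_sTs)
    then show "(\<lambda>n. MzS S T a b c (s n) u) \<longlonglongrightarrow> 0"
      by simp
  qed
next
  assume M: "S_lim_zero X S (\<lambda>x. MzS S T a b c x u) u"
  show "S_continuous_at X S T u"
    unfolding S_continuous_at_def
  proof (intro allI impI)
    fix s assume lim: "S_converges X S s u"
    then have s: "s n \<in> X" for n
      by (auto simp: S_converges_def)
    note Ts = T_closed[OF s]
    have "(\<lambda>n. S (T (s n)) (T (s n)) u) \<longlonglongrightarrow> 0"
    proof (rule tendsto_sandwich)
      show "eventually (\<lambda>n. 0 \<le> S (T (s n)) (T (s n)) u) sequentially"
        by (rule always_eventually) (blast intro: nonneg[OF Ts Ts u])
      show "eventually (\<lambda>n. S (T (s n)) (T (s n)) u \<le> MzS S T a b c (s n) u) sequentially"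
        using dominated[OF s u] fixed by (intro always_eventually) simp
      show "(\<lambda>n. MzS S T a b c (s n) u) \<longlonglongrightarrow> 0"
        using M lim by (simp add: S_lim_zero_def)
    qed simp
    then show "S_converges X S (\<lambda>n. T (s n)) (T u)"
      using u fixed Ts by (auto simp: S_converges_def)
  qed
qed

end

section \<open>From the comparison function to domination by M\<close>

lemma (in S_metric_space) MzS_nonneg:
  assumes "x \<in> X" "y \<in> X" "T x \<in> X" "T y \<in> X" and "0 \<le> a"
  shows "0 \<le> MzS S T a b c x y"
proof -
  have "0 \<le> a * S x x y"
    using assms nonneg by simp
  then show ?thesis
    by (simp add: MzS_def)
qed

lemma (in S_metric_space) MzS_eq_0_imp_eq:
  assumes X: "x \<in> X" "y \<in> X" "T x \<in> X" "T y \<in> X"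
    and nonneg_abc: "0 \<le> a" "0 \<le> b" "0 \<le> c"
    and pos: "a > 0 \<or> b > 0 \<and> c > 0"
    and zero: "MzS S T a b c x y = 0"
  shows "x = y"
proof -
  have terms: "a * S x x y \<le> 0" "b * (S x x (T x) + S y y (T y)) \<le> 0"
      "c * (S x x (T y) + S y y (T x)) \<le> 0"
    using zero by (auto simp: MzS_def max_def split: if_splits)
  have ge: "0 \<le> S x x y" "0 \<le> S x x (T x)" "0 \<le> S y y (T y)" "0 \<le> S x x (T y)" "0 \<le> S y y (T x)"
    using X nonneg by auto
  consider "a > 0" | "b > 0" "c > 0"
    using pos by blast
  then show ?thesis
  proof cases
    case 1
    then have "S x x y = 0"
      using terms(1) ge(1) by (simp add: mult_le_0_iff)
    then show ?thesis
      using S_eq_0_iff X by blast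
  next
    case 2
    \<comment> \<open>Vanishing of the last two terms gives \<open>x = T y\<close> and \<open>y = T y\<close>.\<close>
    then have "S y y (T y) = 0" "S x x (T y) = 0"
      using terms(2,3) ge by (auto simp: mult_le_0_iff)
    then show ?thesis
      using S_eq_0_iff X by metis
  qed
qed

lemma (in S_metric_space) dominated_if_comparison_function:
  assumes X: "x \<in> X" "y \<in> X" "T x \<in> X" "T y \<in> X"
    and nonneg_abc: "0 \<le> a" "0 \<le> b" "0 \<le> c"
    and below: "\<And>t. t > 0 \<Longrightarrow> \<phi> t < t"
    and at_0: "a = 0 \<and> (b = 0 \<or> c = 0) \<Longrightarrow> \<phi> 0 = 0"
    and le: "S (T x) (T x) (T y) \<le> \<phi> (MzS S T a b c x y)"
  shows "S (T x) (T x) (T y) \<le> MzS S T a b c x y"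
proof (cases "MzS S T a b c x y = 0")
  case True
  show ?thesis
  proof (cases "a = 0 \<and> (b = 0 \<or> c = 0)")
    case degenerate: True
    then show ?thesis
      using at_0 le True by simp
  next
    case False
    then have "a > 0 \<or> b > 0 \<and> c > 0"
      using nonneg_abc by auto
    then have "x = y"
      by (rule MzS_eq_0_imp_eq[OF X nonneg_abc _ True])
    then show ?thesis
      using True S_self X by simp
  qed
next
  case False
  then have "MzS S T a b c x y > 0"
    using MzS_nonneg[OF X nonneg_abc(1), of b c] by simp
  then show ?thesis
    using below le by fastforce
qed

theorem theorem2p1:
  fixes X :: "'a set" and S :: "'a \<Rightarrow> 'a \<Rightarrow> 'a \<Rightarrow> real"
    and T :: "'a \<Rightarrow> 'a" and a b c :: real
  assumes "complete_S_metric_space X S"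
    and "T \<in> X \<rightarrow> X"
    and "0 \<le> a" "a < 1" and "0 \<le> b" "b < 1" and "0 \<le> c" "c \<le> 1 / 2"
    and "\<exists>\<phi> :: real \<Rightarrow> real. \<phi> \<in> {0..} \<rightarrow> {0..} \<and> (\<forall>t>0. \<phi> t < t) \<and>
           (a = 0 \<and> (b = 0 \<or> c = 0) \<longrightarrow> \<phi> 0 = 0) \<and>
           (\<forall>x\<in>X. \<forall>y\<in>X. S (T x) (T x) (T y) \<le> \<phi> (MzS S T a b c x y))"
    and "\<forall>\<epsilon>>0. \<exists>\<delta>>0. \<forall>x\<in>X. \<forall>y\<in>X.
           \<epsilon> < MzS S T a b c x y \<and> MzS S T a b c x y < \<epsilon> + \<delta> \<longrightarrow> S (T x) (T x) (T y) \<le> \<epsilon>"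
  shows "(\<exists>!u. u \<in> X \<and> T u = u) \<and>
         (\<forall>u\<in>X. T u = u \<longrightarrow>
            (\<not> S_continuous_at X S T u \<longleftrightarrow> \<not> S_lim_zero X S (\<lambda>x. MzS S T a b c x u) u))"
proof -
  interpret complete_S_metric_space X S by fact
  have T: "T x \<in> X" if "x \<in> X" for x
    using assms(2) that by blast
  obtain \<phi> :: "real \<Rightarrow> real" where \<phi>: "\<And>t. t > 0 \<Longrightarrow> \<phi> t < t"
      "a = 0 \<and> (b = 0 \<or> c = 0) \<Longrightarrow> \<phi> 0 = 0"
      "\<And>x y. \<lbrakk>x \<in> X; y \<in> X\<rbrakk> \<Longrightarrow> S (T x) (T x) (T y) \<le> \<phi> (MzS S T a b c x y)"
    using assms(9) by blast
  interpret M_dominated_map X S T a b c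
  proof unfold_locales
    fix x y assume "x \<in> X" "y \<in> X"
    then show "S (T x) (T x) (T y) \<le> MzS S T a b c x y"
      using dominated_if_comparison_function[of x y T a b c \<phi>] T \<phi> assms(3,5,7) by blast
  qed (use T assms in auto)
  show ?thesis
    using fixed_point_exists fixed_point_unique continuous_at_fixed_point_iff by blast
qed

end
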